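(* Let $n,k$ be powers of $2$ with $2\le k\le n/2$. Let $\bar l=\langle l_1,\dots,l_{n/2}\rangle\in\mathbb N^{n/2}$ be top $k$ sorted, let $\bar r=\langle r_1,\dots,r_{n/2}\rangle\in\mathbb N^{n/2}$ be top $k/2$ sorted, and assume $l_i\ge r_i$ for all $1\le i\le k/2$. Apply the comparator network $pw\_hbit\_merge^n_k$ to $\bar l::\bar r$: (1) compute $\bar y=bit\_split^k(l_{k/2+1},\dots,l_k,r_1,\dots,r_{k/2})$ and let $\bar b=\langle l_1,\dots,l_{k/2}\rangle::\langle y_1,\dots,y_{k/2}\rangle$ (a sequence of length $k$); (2) compute $half\_bit\_merge^k(\bar b)$. Then the output of step (2) is sorted and coincides with the first $k$ entries of the nonincreasing rearrangement of $\bar l::\bar r$ (i.e. it consists of the $k$ largest elements of $\bar l::\bar r$, in sorted order). Moreover, the network $pw\_hbit\_merge^n_k$ consists of exactly $\frac{k\log_2 k}{2}$ comparators.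
   Context: A sequence $\bar x=\langle x_1,\dots,x_m\rangle\in\mathbb N^m$ is sorted if $x_1\ge x_2\ge\dots\ge x_m$. For sequences $\bar x,\bar y$, $\bar x::\bar y$ denotes concatenation; $left(\bar x)$ and $right(\bar x)$ denote the first and second halves of a sequence of even length. For $\bar x\in\mathbb N^p$, $\bar y\in\mathbb N^q$, write $\bar x\succeq\bar y$ if $x_i\ge y_j$ for all $i,j$. A sequence $\bar x\in\mathbb N^m$ is top $k$ sorted ($k\le m$) if $\langle x_1,\dots,x_k\rangle$ is sorted and $\langle x_1,\dots,x_k\rangle\succeq\langle x_{k+1},\dots,x_m\rangle$. A comparator $c_{i,j}$ ($i<j$) acting on a sequence replaces the entry at position $i$ by the maximum and the entry at position $j$ by the minimum of the two entries, leaving the others unchanged; a comparator network is a composition of finitely many comparators, and its size is the number of comparators. For $m$ even: $split^m$ applies the comparators $c_{i,m/2+i}$ for $i=1,\dots,m/2$; $bit\_split^m$ applies $c_{i,m-i+1}$ for $i=1,\dots,m/2$ (these comparators act on disjoint pairs). For $m$ a power of 2, Batcher's bitonic merger $bit\_merge^m$ is: for $m=1$ no comparators; for $m=2$ the single comparator $c_{1,2}$; for $m>2$ apply $split^m$, then recursively $bit\_merge^{m/2}$ to the left half and to the right half. For $m\ge4$ a power of 2, $half\_split^m$ applies the comparators $c_{i,m/2+i}$ for $i=m/4+1,\dots,m/2$ only (i.e. $split^m$ with its first $m/4$ comparators removed). For $m$ a power of $2$, $m\ge2$, $half\_bit\_merge^m(\bar b)$ is: if $m=2$, return $\bar b$ unchanged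 (no comparators); otherwise let $\bar b'=half\_split^m(\bar b)$ and return $half\_bit\_merge^{m/2}(left(\bar b'))::bit\_merge^{m/2}(right(\bar b'))$. *)

theory Defs
  imports Complex_Main
begin

text \<open>Sequences are lists of naturals. Positions are counted from 0, so the comparator
  written \<open>c\<^bsub>i,j\<^esub>\<close> with positions counted from 1 is the pair \<open>(i - 1, j - 1)\<close> here.\<close>

definition power_of_2 :: "nat \<Rightarrow> bool" where
  "power_of_2 m \<longleftrightarrow> (\<exists>p. m = 2 ^ p)"

definition sorted_seq :: "nat list \<Rightarrow> bool" where
  "sorted_seq xs \<longleftrightarrow> sorted_wrt (\<ge>) xs"

definition dominates :: "nat list \<Rightarrow> nat list \<Rightarrow> bool" where
  "dominates xs ys \<longleftrightarrow> (\<forall>x\<in>set xs. \<forall>y\<in>set ys. x \<ge> y)"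

definition top_sorted :: "nat \<Rightarrow> nat list \<Rightarrow> bool" where
  "top_sorted k xs \<longleftrightarrow>
     k \<le> length xs \<and> sorted_seq (take k xs) \<and> dominates (take k xs) (drop k xs)"

type_synonym comparator = "nat \<times> nat"

text \<open>A network lists its comparators in order of application; its size is its length.\<close>

type_synonym network = "comparator list"

definition network_on :: "nat \<Rightarrow> network \<Rightarrow> bool" where
  "network_on m N \<longleftrightarrow> (\<forall>(i, j)\<in>set N. i < j \<and> j < m)"

fun compare :: "comparator \<Rightarrow> nat list \<Rightarrow> nat list" where
  "compare (i, j) xs = xs[i := max (xs ! i) (xs ! j), j := min (xs ! i) (xs ! j)]"

definition run :: "network \<Rightarrow> nat list \<Rightarrow> nat list" where
  "run N xs = fold compare N xs"

definition relabel :: "(nat \<Rightarrow> nat) \<Rightarrow> network \<Rightarrow> network" where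
  "relabel f N = map (\<lambda>(i, j). (f i, f j)) N"

text \<open>\<open>N1\<close> on the first \<open>h\<close> positions and \<open>N2\<close> on the positions from \<open>h\<close> on.\<close>

definition par :: "nat \<Rightarrow> network \<Rightarrow> network \<Rightarrow> network" where
  "par h N1 N2 = N1 @ relabel (\<lambda>i. h + i) N2"

definition split_net :: "nat \<Rightarrow> network" where
  "split_net m = map (\<lambda>i. (i, m div 2 + i)) [0..<m div 2]"

definition bit_split :: "nat \<Rightarrow> network" where
  "bit_split m = map (\<lambda>i. (i, m - 1 - i)) [0..<m div 2]"

definition half_split :: "nat \<Rightarrow> network" where
  "half_split m = map (\<lambda>i. (i, m div 2 + i)) [m div 4..<m div 2]"

text \<open>The two recursive networks are only meaningful when \<open>m\<close> is a power of 2
  (and \<open>m \<ge> 2\<close> for \<open>half_bit_merge\<close>); other values are merely a totalisation.\<close>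

fun bit_merge :: "nat \<Rightarrow> network" where
  "bit_merge m =
     (if m \<le> 1 then []
      else if m = 2 then [(0, 1)]
      else split_net m @ par (m div 2) (bit_merge (m div 2)) (bit_merge (m div 2)))"

fun half_bit_merge :: "nat \<Rightarrow> network" where
  "half_bit_merge m =
     (if m \<le> 2 then []
      else half_split m @ par (m div 2) (half_bit_merge (m div 2)) (bit_merge (m div 2)))"

declare bit_merge.simps [simp del] half_bit_merge.simps [simp del]

text \<open>The whole network on \<open>n\<close> positions holding \<open>l @ r\<close>. Its first step is \<open>bit_split k\<close> wired to
  the second half of the first \<open>k\<close> positions of \<open>l\<close> followed by the first \<open>k div 2\<close> positions of \<open>r\<close>.
  The upper outputs of that step thereby land in positions \<open>k div 2, \<dots>, k - 1\<close>, so the second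
  step acts on the first \<open>k\<close> positions; see \<open>run_pw_hbit_merge\<close> below.\<close>

definition pw_hbit_merge :: "nat \<Rightarrow> nat \<Rightarrow> network" where
  "pw_hbit_merge n k =
     relabel (\<lambda>i. if i < k div 2 then k div 2 + i else n div 2 + (i - k div 2)) (bit_split k)
     @ half_bit_merge k"

lemma length_compare [simp]: "length (compare c xs) = length xs"
  by (cases c) simp

lemma run_Nil [simp]: "run [] xs = xs"
  by (simp add: run_def)

lemma run_Cons [simp]: "run (c # N) xs = run N (compare c xs)"
  by (simp add: run_def)

lemma run_append [simp]: "run (N @ N') xs = run N' (run N xs)"
  by (simp add: run_def)

lemma length_run [simp]: "length (run N xs) = length xs"
  by (induction N arbitrary: xs) simp_all

lemma network_on_Nil [simp]: "network_on m []"
  by (simp add: network_on_def)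

lemma network_on_Cons [simp]:
  "network_on m ((i, j) # N) \<longleftrightarrow> i < j \<and> j < m \<and> network_on m N"
  by (auto simp: network_on_def)

lemma network_on_append [simp]:
  "network_on m (N @ N') \<longleftrightarrow> network_on m N \<and> network_on m N'"
  by (auto simp: network_on_def)

lemma network_on_mono: "network_on m N \<Longrightarrow> m \<le> m' \<Longrightarrow> network_on m' N"
  by (fastforce simp: network_on_def)

lemma network_on_par:
  assumes "network_on h N1" "network_on h' N2" "h + h' \<le> m"
  shows "network_on m (par h N1 N2)"
  using assms by (fastforce simp: network_on_def par_def relabel_def)

lemma network_on_split_net: "network_on m (split_net m)"
  by (auto simp: network_on_def split_net_def)

lemma network_on_bit_split: "network_on m (bit_split m)"
  by (auto simp: network_on_def bit_split_def)

lemma network_on_half_split: "network_on m (half_split m)"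
  by (auto simp: network_on_def half_split_def)

lemma network_on_bit_merge: "network_on m (bit_merge m)"
proof (induction m rule: less_induct)
  case (less m)
  show ?case
  proof (cases "m \<le> 2")
    case True
    then show ?thesis by (subst bit_merge.simps) auto
  next
    case False
    then have "network_on (m div 2) (bit_merge (m div 2))" by (intro less) auto
    then have "network_on m (par (m div 2) (bit_merge (m div 2)) (bit_merge (m div 2)))"
      by (intro network_on_par) auto
    then show ?thesis
      using False by (subst bit_merge.simps) (simp add: network_on_split_net)
  qed
qed

lemma network_on_half_bit_merge: "network_on m (half_bit_merge m)"
proof (induction m rule: less_induct)
  case (less m)
  show ?case
  proof (cases "m \<le> 2")
    case True
    then show ?thesis by (subst half_bit_merge.simps) auto
  next
    case False
    then have "network_on (m div 2) (half_bit_merge (m div 2))" by (intro less) auto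
    then have "network_on m (par (m div 2) (half_bit_merge (m div 2)) (bit_merge (m div 2)))"
      by (intro network_on_par) (auto intro: network_on_bit_merge)
    then show ?thesis
      using False by (subst half_bit_merge.simps) (simp add: network_on_half_split)
  qed
qed

lemma network_on_pw_hbit_merge:
  assumes "even k" "k \<le> n div 2"
  shows "network_on n (pw_hbit_merge n k)"
proof -
  obtain h where "k = 2 * h" using assms(1) by blast
  then have "network_on n (relabel (\<lambda>i. if i < k div 2 then k div 2 + i else n div 2 + (i - k div 2))
      (bit_split k))"
    using assms(2) by (auto simp: network_on_def relabel_def bit_split_def)
  moreover have "network_on n (half_bit_merge k)"
    using assms(2) by (intro network_on_mono[OF network_on_half_bit_merge]) auto
  ultimately show ?thesis by (simp add: pw_hbit_merge_def)
qed

lemma run_on_prefix: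
  assumes "network_on (length xs) N"
  shows "run N (xs @ ys) = run N xs @ ys"
  using assms
proof (induction N arbitrary: xs)
  case (Cons c N)
  obtain i j where c: "c = (i, j)" by (cases c)
  then have "compare c (xs @ ys) = compare c xs @ ys"
    using Cons.prems by (simp add: nth_append list_update_append)
  with Cons c show ?case by simp
qed simp

lemma run_shift: "run (relabel (\<lambda>i. length xs + i) N) (xs @ ys) = xs @ run N ys"
proof (induction N arbitrary: ys)
  case (Cons c N)
  obtain i j where "c = (i, j)" by (cases c)
  then show ?case using Cons[of "compare c ys"]
    by (simp add: relabel_def nth_append list_update_append)
qed (simp add: relabel_def)

lemma run_par:
  assumes "network_on h N1" "h \<le> length xs"
  shows "run (par h N1 N2) xs = run N1 (take h xs) @ run N2 (drop h xs)"
proof -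
  have "run N1 xs = run N1 (take h xs) @ drop h xs"
    using run_on_prefix[of "take h xs" N1 "drop h xs"] assms by simp
  then show ?thesis
    using run_shift[of "run N1 (take h xs)" N2 "drop h xs"] assms by (simp add: par_def)
qed

lemma run_bit_merge:
  assumes "m > 2" "length xs = m"
  shows "run (bit_merge m) xs =
    (let ys = run (split_net m) xs
     in run (bit_merge (m div 2)) (take (m div 2) ys) @ run (bit_merge (m div 2)) (drop (m div 2) ys))"
  using assms by (subst bit_merge.simps) (simp add: Let_def run_par network_on_bit_merge)

lemma run_half_bit_merge:
  assumes "m > 2" "length xs = m"
  shows "run (half_bit_merge m) xs =
    (let ys = run (half_split m) xs
     in run (half_bit_merge (m div 2)) (take (m div 2) ys) @ run (bit_merge (m div 2)) (drop (m div 2) ys))"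
  using assms by (subst half_bit_merge.simps) (simp add: Let_def run_par network_on_half_bit_merge)

lemma run_relabel:
  assumes "network_on (length ys) N" "inj_on f {..<length ys}"
    and "\<And>i. i < length ys \<Longrightarrow> f i < length xs \<and> xs ! f i = ys ! i"
  shows "(\<forall>i<length ys. run (relabel f N) xs ! f i = run N ys ! i) \<and>
    (\<forall>p. p \<notin> f ` {..<length ys} \<longrightarrow> run (relabel f N) xs ! p = xs ! p)"
  using assms
proof (induction N arbitrary: xs ys)
  case Nil
  then show ?case by (simp add: relabel_def)
next
  case (Cons c N)
  obtain i j where c: "c = (i, j)" by (cases c)
  have ij: "i < j" "i < length ys" "j < length ys" using Cons.prems(1) c by auto
  let ?xs = "compare (f i, f j) xs" and ?ys = "compare (i, j) ys"
  have eq: "f a = f b \<longleftrightarrow> a = b" if "a < length ys" "b < length ys" for a b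
    using Cons.prems(2) that by (auto dest: inj_onD)
  have 1: "f a < length ?xs \<and> ?xs ! f a = ?ys ! a" if "a < length ?ys" for a
    using that ij Cons.prems(3) by (auto simp: nth_list_update eq)
  have 2: "?xs ! p = xs ! p" if "p \<notin> f ` {..<length ys}" for p
  proof -
    have "p \<noteq> f i" "p \<noteq> f j" using that ij by auto
    then show ?thesis by simp
  qed
  have "(\<forall>i<length ?ys. run (relabel f N) ?xs ! f i = run N ?ys ! i) \<and>
    (\<forall>p. p \<notin> f ` {..<length ?ys} \<longrightarrow> run (relabel f N) ?xs ! p = ?xs ! p)"
    using Cons.prems c 1 by (intro Cons.IH) auto
  then show ?case using 2 by (simp add: c relabel_def)
qed

lemma run_pw_hbit_merge:
  assumes "even k" "k \<le> n div 2" "length l = n div 2" "length r = n div 2"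
  defines "y \<equiv> run (bit_split k) (drop (k div 2) (take k l) @ take (k div 2) r)"
  shows "take k (run (pw_hbit_merge n k) (l @ r)) =
    run (half_bit_merge k) (take (k div 2) l @ take (k div 2) y)"
proof -
  obtain h where k: "k = 2 * h" using assms(1) by blast
  define f where "f = (\<lambda>i. if i < k div 2 then k div 2 + i else n div 2 + (i - k div 2))"
  define ys where "ys = drop h (take k l) @ take h r"
  define z where "z = run (relabel f (bit_split k)) (l @ r)"
  have len: "length ys = k" using assms k by (simp add: ys_def)
  have y: "y = run (bit_split k) ys" by (simp add: y_def ys_def k)
  have "(\<forall>i<length ys. z ! f i = run (bit_split k) ys ! i) \<and>
    (\<forall>p. p \<notin> f ` {..<length ys} \<longrightarrow> z ! p = (l @ r) ! p)"
    unfolding z_def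
  proof (rule run_relabel)
    show "network_on (length ys) (bit_split k)" by (simp add: len network_on_bit_split)
    show "inj_on f {..<length ys}"
      using assms(2) by (auto simp: inj_on_def f_def len k split: if_splits)
    show "f i < length (l @ r) \<and> (l @ r) ! f i = ys ! i" if "i < length ys" for i
    proof (cases "i < h")
      case True
      then show ?thesis using assms(2-4) k by (simp add: f_def ys_def nth_append)
    next
      case False
      then obtain d where "i = h + d" using le_Suc_ex by (metis not_less)
      then show ?thesis using that assms(2-4) k len by (simp add: f_def ys_def nth_append)
    qed
  qed
  then have zy: "\<And>i. i < k \<Longrightarrow> z ! f i = y ! i"
    and zl: "\<And>p. p \<notin> f ` {..<k} \<Longrightarrow> z ! p = (l @ r) ! p"
    using len y by auto
  have "take k z = take h l @ take h y"
  proof (rule nth_equalityI)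
    show "length (take k z) = length (take h l @ take h y)"
      using assms(2-4) k len by (simp add: z_def y)
    fix p assume "p < length (take k z)"
    then have p: "p < 2 * h" by (simp add: k)
    show "take k z ! p = (take h l @ take h y) ! p"
    proof (cases "p < h")
      case True
      have "p \<notin> f ` {..<k}" using True assms(2) by (auto simp: f_def k)
      then show ?thesis using True assms(2-4) k by (simp add: zl nth_append)
    next
      case False
      then have "f (p - h) = p" using p by (auto simp: f_def k)
      then show ?thesis
        using zy[of "p - h"] False p assms(2-4) k len by (simp add: nth_append y)
    qed
  qed
  moreover have "run (half_bit_merge k) z = run (half_bit_merge k) (take k z) @ drop k z"
    using run_on_prefix[of "take k z" "half_bit_merge k" "drop k z"] assms(2-4)
    by (simp add: z_def network_on_half_bit_merge)
  moreover have "run (pw_hbit_merge n k) (l @ r) = run (half_bit_merge k) z"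
    by (simp add: pw_hbit_merge_def f_def z_def)
  ultimately show ?thesis
    using assms(2-4) len by (simp add: k y)
qed

end

theory Submission
  imports Defs "HOL-Library.Multiset"
begin

text \<open>The list \<open>b\<close> first decreases and then increases (it is V-shaped), and each entry of its first
  half is at least its mirror image. Under these two conditions the comparators that
  \<open>half_split\<close> omits from \<open>split_net\<close> would change nothing, and the upper half of the result
  satisfies the two conditions again while the lower half is bitonic; so the recursion sorts.
  Bitonicity is expressed through thresholds, as in the zero-one principle: for no \<open>t\<close>
  does the truth value of \<open>t \<le> xs ! i\<close> alternate along four positions. Finally, every entry of \<open>b\<close>
  is at least every entry outside \<open>b\<close>.\<close>

section \<open>Shape conditions on lists\<close>

text \<open>Equivalently, the truth value changes at most twice along the positions, so those where
  \<open>P\<close> holds form a cyclic interval. Stated with equivalences, the condition is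
  invariant under negation.\<close>

definition alternation_free :: "nat \<Rightarrow> (nat \<Rightarrow> bool) \<Rightarrow> bool" where
  "alternation_free n P \<longleftrightarrow> (\<forall>i j k l. i < j \<longrightarrow> j < k \<longrightarrow> k < l \<longrightarrow> l < n \<longrightarrow>
     (P i \<longleftrightarrow> P k) \<longrightarrow> (P j \<longleftrightarrow> P l) \<longrightarrow> (P i \<longleftrightarrow> P j))"

definition bitonic :: "nat list \<Rightarrow> bool" where
  "bitonic xs \<longleftrightarrow> (\<forall>t. alternation_free (length xs) (\<lambda>i. t \<le> xs ! i))"

text \<open>Discrete quasiconvexity. As it names no turning point, it passes to pointwise maxima
  without case distinctions.\<close>

definition v_shaped :: "nat list \<Rightarrow> bool" where
  "v_shaped xs \<longleftrightarrow>
     (\<forall>i j k. i \<le> j \<longrightarrow> j \<le> k \<longrightarrow> k < length xs \<longrightarrow> xs ! j \<le> max (xs ! i) (xs ! k))"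

definition mirror_dominating :: "nat list \<Rightarrow> bool" where
  "mirror_dominating xs \<longleftrightarrow> (\<forall>i < length xs div 2. xs ! (length xs - 1 - i) \<le> xs ! i)"

definition uppers :: "nat list \<Rightarrow> nat list" where
  "uppers xs = map (\<lambda>i. max (xs ! i) (xs ! (length xs div 2 + i))) [0..<length xs div 2]"

definition lowers :: "nat list \<Rightarrow> nat list" where
  "lowers xs = map (\<lambda>i. min (xs ! i) (xs ! (length xs div 2 + i))) [0..<length xs div 2]"

lemma length_uppers [simp]: "length (uppers xs) = length xs div 2"
  by (simp add: uppers_def)

lemma length_lowers [simp]: "length (lowers xs) = length xs div 2"
  by (simp add: lowers_def)

lemma nth_uppers [simp]:
  "i < length xs div 2 \<Longrightarrow> uppers xs ! i = max (xs ! i) (xs ! (length xs div 2 + i))"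
  by (simp add: uppers_def)

lemma nth_lowers [simp]:
  "i < length xs div 2 \<Longrightarrow> lowers xs ! i = min (xs ! i) (xs ! (length xs div 2 + i))"
  by (simp add: lowers_def)

section \<open>Effect of a single layer of comparators\<close>

text \<open>No comparator sees a position that an earlier one has changed, so every result refers to
  the input \<open>xs\<close>. The layers \<open>split_net\<close>, \<open>half_split\<close> and
  \<open>bit_split\<close> are all instances.\<close>

lemma run_disjoint:
  assumes "distinct js" "inj_on g (set js)" "g ` set js \<inter> set js = {}"
    and "\<And>i. i \<in> set js \<Longrightarrow> i < length xs \<and> g i < length xs"
  shows "(\<forall>i\<in>set js. run (map (\<lambda>i. (i, g i)) js) xs ! i = max (xs ! i) (xs ! g i) \<and>
      run (map (\<lambda>i. (i, g i)) js) xs ! g i = min (xs ! i) (xs ! g i)) \<and>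
    (\<forall>p. p \<notin> set js \<union> g ` set js \<longrightarrow> run (map (\<lambda>i. (i, g i)) js) xs ! p = xs ! p)"
  using assms
proof (induction js arbitrary: xs)
  case (Cons a js)
  let ?xs = "compare (a, g a) xs"
  let ?N = "map (\<lambda>i. (i, g i)) js"
  have a: "a \<notin> set js" "g a \<notin> g ` set js" "a \<notin> g ` set js" "g a \<notin> set js" "a \<noteq> g a"
    "a < length xs" "g a < length xs"
    using Cons.prems by auto
  have IH: "(\<forall>i\<in>set js. run ?N ?xs ! i = max (?xs ! i) (?xs ! g i) \<and>
      run ?N ?xs ! g i = min (?xs ! i) (?xs ! g i)) \<and>
    (\<forall>p. p \<notin> set js \<union> g ` set js \<longrightarrow> run ?N ?xs ! p = ?xs ! p)"
    using Cons.prems by (intro Cons.IH) auto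
  have old: "?xs ! p = xs ! p" if "p \<noteq> a" "p \<noteq> g a" for p
    using that by simp
  have new: "run ?N ?xs ! a = max (xs ! a) (xs ! g a)" "run ?N ?xs ! g a = min (xs ! a) (xs ! g a)"
    using IH a by auto
  have "run ?N ?xs ! i = max (xs ! i) (xs ! g i) \<and> run ?N ?xs ! g i = min (xs ! i) (xs ! g i)"
    if "i \<in> set js" for i
  proof -
    have "i \<noteq> a" "i \<noteq> g a" "g i \<noteq> a" "g i \<noteq> g a" using a that by (auto simp: image_iff)
    then show ?thesis using IH that old[of i] old[of "g i"] by (simp del: compare.simps)
  qed
  moreover have "run ?N ?xs ! p = xs ! p" if "p \<notin> set (a # js) \<union> g ` set (a # js)" for p
    using IH that old by auto
  ultimately show ?case using new by auto
qed simp

lemma mset_run: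
  assumes "network_on (length xs) N"
  shows "mset (run N xs) = mset xs"
  using assms
proof (induction N arbitrary: xs)
  case (Cons c N)
  obtain i j where c: "c = (i, j)" by (cases c)
  have ij: "i < length xs" "j < length xs" "i \<noteq> j" using Cons.prems c by auto
  have "mset (compare c xs) = mset xs"
  proof (cases "xs ! j \<le> xs ! i")
    case True
    then show ?thesis by (simp add: c max_def min_def)
  next
    case False
    then have "compare c xs = xs[i := xs ! j, j := xs ! i]" by (simp add: c)
    then show ?thesis using ij mset_swap[of j xs i] by simp
  qed
  then show ?case using Cons c by simp
qed simp

lemma run_split_net:
  assumes "length xs = m" "even m"
  shows "run (split_net m) xs = uppers xs @ lowers xs"
proof -
  obtain h where m: "m = 2 * h" using assms(2) by blast
  have R: "i < h \<Longrightarrow> run (split_net m) xs ! i = max (xs ! i) (xs ! (h + i)) \<and>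
      run (split_net m) xs ! (h + i) = min (xs ! i) (xs ! (h + i))" for i
    using run_disjoint[of "[0..<h]" "\<lambda>i. h + i" xs] assms(1)
    by (auto simp: split_net_def m)
  show ?thesis
  proof (rule nth_equalityI)
    fix p assume "p < length (run (split_net m) xs)"
    then have p: "p < 2 * h" by (simp add: assms(1) m)
    show "run (split_net m) xs ! p = (uppers xs @ lowers xs) ! p"
    proof (cases "p < h")
      case False
      then obtain d where "p = h + d" using le_Suc_ex by (metis not_less)
      then show ?thesis using R[of d] p assms(1) by (simp add: nth_append m)
    qed (use R assms(1) in \<open>simp add: nth_append m\<close>)
  qed (simp add: assms(1) m)
qed

lemma run_half_split:
  assumes "length xs = m" "even m" "v_shaped xs" "mirror_dominating xs"
  shows "run (half_split m) xs = uppers xs @ lowers xs"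
proof -
  obtain h where m: "m = 2 * h" using assms(2) by blast
  have q: "m div 4 = h div 2" by (simp add: m)
  \<comment> \<open>For these \<open>i\<close>, position \<open>h + i\<close> lies between
    \<open>i\<close> and its mirror image \<open>m - 1 - i\<close>, and \<open>xs ! i\<close> is the
    larger of those two entries.\<close>
  have D: "xs ! (h + i) \<le> xs ! i" if "i < h div 2" for i
  proof -
    have "xs ! (h + i) \<le> max (xs ! i) (xs ! (m - 1 - i))"
      using assms(1,3) that m unfolding v_shaped_def by auto
    moreover have "xs ! (m - 1 - i) \<le> xs ! i"
      using assms(1,4) that m unfolding mirror_dominating_def by auto
    ultimately show ?thesis by simp
  qed
  have A: "h div 2 \<le> i \<Longrightarrow> i < h \<Longrightarrow> run (half_split m) xs ! i = max (xs ! i) (xs ! (h + i)) \<and>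
      run (half_split m) xs ! (h + i) = min (xs ! i) (xs ! (h + i))" for i
    using run_disjoint[of "[h div 2..<h]" "\<lambda>i. h + i" xs] assms(1)
    unfolding half_split_def q by (auto simp: m)
  have B: "i < h div 2 \<Longrightarrow> run (half_split m) xs ! i = xs ! i \<and>
      run (half_split m) xs ! (h + i) = xs ! (h + i)" for i
    using run_disjoint[of "[h div 2..<h]" "\<lambda>i. h + i" xs] assms(1)
    unfolding half_split_def q by (auto simp: m)
  have R: "run (half_split m) xs ! i = max (xs ! i) (xs ! (h + i)) \<and>
      run (half_split m) xs ! (h + i) = min (xs ! i) (xs ! (h + i))" if "i < h" for i
    using A[of i] B[of i] D[of i] that by (cases "i < h div 2") auto
  show ?thesis
  proof (rule nth_equalityI)
    fix p assume "p < length (run (half_split m) xs)"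
    then have p: "p < 2 * h" by (simp add: assms(1) m)
    show "run (half_split m) xs ! p = (uppers xs @ lowers xs) ! p"
    proof (cases "p < h")
      case False
      then obtain d where "p = h + d" using le_Suc_ex by (metis not_less)
      then show ?thesis using R[of d] p assms(1) by (simp add: nth_append m)
    qed (use R assms(1) in \<open>simp add: nth_append m\<close>)
  qed (simp add: assms(1) m)
qed

section \<open>Bitonic lists and the full merger\<close>

lemma alternation_freeD:
  assumes "alternation_free n P" "i < j" "j < k" "k < l" "l < n"
  shows "\<not> (P i \<and> \<not> P j \<and> P k \<and> \<not> P l)" and "\<not> (\<not> P i \<and> P j \<and> \<not> P k \<and> P l)"
  using assms unfolding alternation_free_def by blast+

lemma alternation_free_not:
  "alternation_free n (\<lambda>i. \<not> P i) \<longleftrightarrow> alternation_free n P"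
  by (simp add: alternation_free_def)

lemma alternation_free_cong:
  assumes "\<And>i. i < n \<Longrightarrow> P i \<longleftrightarrow> Q i"
  shows "alternation_free n P \<longleftrightarrow> alternation_free n Q"
proof -
  have "l < n \<Longrightarrow> i < j \<Longrightarrow> j < k \<Longrightarrow> k < l \<Longrightarrow> P i = Q i \<and> P j = Q j \<and> P k = Q k \<and> P l = Q l"
    for i j k l using assms by auto
  then show ?thesis unfolding alternation_free_def by (smt (verit))
qed

lemma alternation_free_disj:
  assumes "alternation_free n P" "2 * h \<le> n"
  shows "alternation_free h (\<lambda>i. P i \<or> P (h + i))"
  unfolding alternation_free_def
proof (intro allI impI)
  fix i j k l
  assume o: "i < j" "j < k" "k < l" "l < h"
    and e: "P i \<or> P (h + i) \<longleftrightarrow> P k \<or> P (h + k)" "P j \<or> P (h + j) \<longleftrightarrow> P l \<or> P (h + l)"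
  note N = alternation_freeD[OF assms(1)]
  \<comment> \<open>An alternation of the disjunction has two true positions, each witnessed in the
    first or in the second half: four cases for each of the two patterns. In every case one of these
    eight facts excludes the resulting alternation of \<open>P\<close> itself.\<close>
  have "\<not> (\<not> P i \<and> P j \<and> \<not> P k \<and> P l)" "\<not> (P i \<and> \<not> P j \<and> P k \<and> \<not> P l)"
    "\<not> (\<not> P i \<and> P j \<and> \<not> P k \<and> P (h + l))"
    "\<not> (\<not> P (h + i) \<and> P (h + j) \<and> \<not> P (h + k) \<and> P (h + l))"
    "\<not> (P (h + i) \<and> \<not> P (h + j) \<and> P (h + k) \<and> \<not> P (h + l))"
    "\<not> (\<not> P i \<and> P l \<and> \<not> P (h + i) \<and> P (h + j))"
    "\<not> (P i \<and> \<not> P j \<and> P (h + k) \<and> \<not> P (h + l))"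
    "\<not> (\<not> P j \<and> P k \<and> \<not> P l \<and> P (h + i))"
    using o assms(2) by - (rule N; simp)+
  then show "P i \<or> P (h + i) \<longleftrightarrow> P j \<or> P (h + j)" using e by blast
qed

text \<open>De Morgan dual of the disjunction.\<close>

lemma alternation_free_conj:
  assumes "alternation_free n P" "2 * h \<le> n"
  shows "alternation_free h (\<lambda>i. P i \<and> P (h + i))"
  using alternation_free_disj[of n "\<lambda>i. \<not> P i" h] assms alternation_free_not[of h "\<lambda>i. P i \<and> P (h + i)"]
  by (simp add: alternation_free_not)

text \<open>At a fixed threshold a maximum becomes a disjunction; for \<open>lowers\<close> the
  minimum becomes a conjunction.\<close>

lemma bitonic_uppers:
  assumes "bitonic xs"
  shows "bitonic (uppers xs)"
  unfolding bitonic_def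
proof
  fix t
  define h where "h = length xs div 2"
  have "alternation_free h (\<lambda>i. t \<le> xs ! i \<or> t \<le> xs ! (h + i))"
    using assms by (intro alternation_free_disj[where n = "length xs"]) (auto simp: bitonic_def h_def)
  then show "alternation_free (length (uppers xs)) (\<lambda>i. t \<le> uppers xs ! i)"
    by (subst alternation_free_cong[where Q = "\<lambda>i. t \<le> xs ! i \<or> t \<le> xs ! (h + i)"])
      (auto simp: h_def le_max_iff_disj)
qed

lemma bitonic_lowers:
  assumes "bitonic xs"
  shows "bitonic (lowers xs)"
  unfolding bitonic_def
proof
  fix t
  define h where "h = length xs div 2"
  have "alternation_free h (\<lambda>i. t \<le> xs ! i \<and> t \<le> xs ! (h + i))"
    using assms by (intro alternation_free_conj[where n = "length xs"]) (auto simp: bitonic_def h_def)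
  then show "alternation_free (length (lowers xs)) (\<lambda>i. t \<le> lowers xs ! i)"
    by (subst alternation_free_cong[where Q = "\<lambda>i. t \<le> xs ! i \<and> t \<le> xs ! (h + i)"])
      (auto simp: h_def)
qed

text \<open>If \<open>xs ! i\<close> and \<open>xs ! (h + i)\<close> were both smaller than \<open>xs ! j\<close> and \<open>xs ! (h + j)\<close>, these four
  entries would alternate.\<close>

lemma dominates_uppers_lowers:
  assumes "bitonic xs"
  shows "dominates (uppers xs) (lowers xs)"
proof -
  define h where "h = length xs div 2"
  have A: "alternation_free (length xs) (\<lambda>i. t \<le> xs ! i)" for t
    using assms by (simp add: bitonic_def)
  have "lowers xs ! j \<le> uppers xs ! i" if "i < h" "j < h" for i j
  proof (rule ccontr)
    define t where "t = lowers xs ! j"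
    assume "\<not> ?thesis"
    then have c: "\<not> t \<le> xs ! i" "\<not> t \<le> xs ! (h + i)" "t \<le> xs ! j" "t \<le> xs ! (h + j)"
      using that by (auto simp: t_def h_def)
    have h: "h + i < length xs" "h + j < length xs" using that by (auto simp: h_def)
    have "i \<noteq> j" using c by auto
    then consider "i < j" | "j < i" by linarith
    then show False
    proof cases
      case 1
      then show False using alternation_freeD(2)[OF A 1, of "h + i" "h + j" t] c h that by auto
    next
      case 2
      then show False using alternation_freeD(1)[OF A 2, of "h + j" "h + i" t] c h that by auto
    qed
  qed
  then show ?thesis by (auto simp: dominates_def h_def in_set_conv_nth)
qed

text \<open>Lets domination between two halves survive the recursive merges, which only permute each
  half.\<close>

lemma dominates_mset:
  assumes "mset xs = mset xs'" "mset ys = mset ys'"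
  shows "dominates xs ys \<longleftrightarrow> dominates xs' ys'"
  using assms unfolding dominates_def by (metis mset_eq_setD)

lemma sorted_seq_append:
  "sorted_seq (xs @ ys) \<longleftrightarrow> sorted_seq xs \<and> sorted_seq ys \<and> dominates xs ys"
  by (auto simp: sorted_seq_def dominates_def sorted_wrt_append)

lemma sorted_bit_merge:
  assumes "length xs = 2 ^ p" "bitonic xs"
  shows "sorted_seq (run (bit_merge (2 ^ p)) xs)"
  using assms
proof (induction p arbitrary: xs)
  case 0
  then show ?case by (subst bit_merge.simps) (auto simp: sorted_seq_def length_Suc_conv)
next
  case (Suc p)
  show ?case
  \<comment> \<open>Length 2 is a base case of \<open>bit_merge\<close> as well;
    \<open>run_bit_merge\<close> requires \<open>m > 2\<close>.\<close>
  proof (cases "p = 0")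
    case True
    then obtain a b where "xs = [a, b]" using Suc.prems by (auto simp: length_Suc_conv numeral_2_eq_2)
    then show ?thesis using True by (subst bit_merge.simps) (simp add: sorted_seq_def)
  next
    case False
    then have "(2::nat) ^ Suc p > 2" using one_less_power[of "2::nat" p] by simp
    then have "run (bit_merge (2 ^ Suc p)) xs =
        run (bit_merge (2 ^ p)) (uppers xs) @ run (bit_merge (2 ^ p)) (lowers xs)"
      using Suc.prems by (simp add: run_bit_merge run_split_net)
    moreover have "dominates (run (bit_merge (2 ^ p)) (uppers xs)) (run (bit_merge (2 ^ p)) (lowers xs))
        \<longleftrightarrow> dominates (uppers xs) (lowers xs)"
      using Suc.prems by (intro dominates_mset mset_run) (simp_all add: network_on_bit_merge)
    ultimately show ?thesis
      using Suc by (simp add: sorted_seq_append bitonic_uppers bitonic_lowers dominates_uppers_lowers)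
  qed
qed

section \<open>V-shaped lists and the half merger\<close>

text \<open>Among four alternating positions, one of the inner two reaches the threshold between two
  that do not, against the V-shape.\<close>

lemma bitonic_if_v_shaped:
  assumes "v_shaped xs"
  shows "bitonic xs"
  unfolding bitonic_def alternation_free_def
proof (intro allI impI)
  fix t i j k l
  assume o: "i < j" "j < k" "k < l" "l < length xs"
    and e: "t \<le> xs ! i \<longleftrightarrow> t \<le> xs ! k" "t \<le> xs ! j \<longleftrightarrow> t \<le> xs ! l"
  have "xs ! j \<le> max (xs ! i) (xs ! k)" "xs ! k \<le> max (xs ! j) (xs ! l)"
    using assms o unfolding v_shaped_def by auto
  then show "t \<le> xs ! i \<longleftrightarrow> t \<le> xs ! j" using e by linarith
qed

lemma v_shaped_uppers:
  assumes "v_shaped xs"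
  shows "v_shaped (uppers xs)"
  unfolding v_shaped_def
proof (intro allI impI)
  fix i j k
  define h where "h = length xs div 2"
  assume o: "i \<le> j" "j \<le> k" and "k < length (uppers xs)"
  then have k: "k < h" "2 * h \<le> length xs" by (auto simp: h_def)
  then have "xs ! j \<le> max (xs ! i) (xs ! k)" "xs ! (h + j) \<le> max (xs ! (h + i)) (xs ! (h + k))"
    using assms o unfolding v_shaped_def by auto
  then show "uppers xs ! j \<le> max (uppers xs ! i) (uppers xs ! k)"
    using k o by (auto simp: h_def[symmetric])
qed

lemma mirror_dominating_uppers:
  assumes "v_shaped xs" "mirror_dominating xs" "even (length xs)"
  shows "mirror_dominating (uppers xs)"
  unfolding mirror_dominating_def
proof (intro allI impI)
  fix i
  define h where "h = length xs div 2"
  have m: "length xs = 2 * h" using assms(3) by (simp add: h_def)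
  assume "i < length (uppers xs) div 2"
  then have i: "i < h div 2" by (simp add: h_def)
  \<comment> \<open>The entry of \<open>uppers xs\<close> mirrored to \<open>i\<close> is the
    maximum of \<open>xs\<close> at \<open>h - 1 - i\<close> and \<open>2 * h - 1 - i\<close>. The
    latter position is the mirror image of \<open>i\<close> in \<open>xs\<close>, and the former
    lies between the two.\<close>
  have "xs ! (2 * h - 1 - i) \<le> xs ! i"
    using assms(2) i unfolding mirror_dominating_def m by auto
  moreover have "xs ! (h - 1 - i) \<le> max (xs ! i) (xs ! (2 * h - 1 - i))"
    using assms(1) i unfolding v_shaped_def m by auto
  moreover have "h + (h - 1 - i) = 2 * h - 1 - i" using i by auto
  ultimately show "uppers xs ! (length (uppers xs) - 1 - i) \<le> uppers xs ! i"
    using i by (auto simp: m)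
qed

lemma sorted_half_bit_merge:
  assumes "length xs = 2 ^ Suc p" "v_shaped xs" "mirror_dominating xs"
  shows "sorted_seq (run (half_bit_merge (2 ^ Suc p)) xs)"
  using assms
proof (induction p arbitrary: xs)
  case 0
  then obtain a b where "xs = [a, b]" by (auto simp: length_Suc_conv numeral_2_eq_2)
  \<comment> \<open>\<open>half_bit_merge 2\<close> is empty, and for two entries mirror domination
    is sortedness.\<close>
  then show ?case using 0
    by (subst half_bit_merge.simps) (auto simp: sorted_seq_def mirror_dominating_def)
next
  case (Suc p)
  let ?m = "2 ^ Suc p :: nat"
  have "(2::nat) ^ Suc (Suc p) > 2" using one_less_power[of "2::nat" "Suc p"] by simp
  then have "run (half_bit_merge (2 ^ Suc (Suc p))) xs =
      run (half_bit_merge ?m) (uppers xs) @ run (bit_merge ?m) (lowers xs)"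
    using Suc.prems by (simp add: run_half_bit_merge run_half_split)
  moreover have "dominates (run (half_bit_merge ?m) (uppers xs)) (run (bit_merge ?m) (lowers xs))
      \<longleftrightarrow> dominates (uppers xs) (lowers xs)"
    using Suc.prems by (intro dominates_mset mset_run)
      (simp_all add: network_on_bit_merge network_on_half_bit_merge)
  moreover have "sorted_seq (run (half_bit_merge ?m) (uppers xs))"
    using Suc.prems by (intro Suc.IH) (simp_all add: v_shaped_uppers mirror_dominating_uppers)
  moreover have "bitonic xs" using Suc.prems by (simp add: bitonic_if_v_shaped)
  moreover have "sorted_seq (run (bit_merge ?m) (lowers xs))"
    using Suc.prems \<open>bitonic xs\<close> by (intro sorted_bit_merge) (simp_all add: bitonic_lowers)
  ultimately show ?case
    by (simp add: sorted_seq_append dominates_uppers_lowers)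
qed

section \<open>Comparator counts\<close>

text \<open>Each of the \<open>p\<close> levels has half of \<open>2 ^ p\<close> comparators;
  doubling avoids the division.\<close>

lemma length_bit_merge: "2 * length (bit_merge (2 ^ p)) = p * 2 ^ p"
proof (induction p)
  case (Suc p)
  show ?case
  proof (cases "p = 0")
    case False
    then have "(2::nat) ^ Suc p > 2" using one_less_power[of "2::nat" p] by simp
    then show ?thesis using Suc
      by (subst bit_merge.simps) (simp add: split_net_def par_def relabel_def algebra_simps)
  qed (subst bit_merge.simps, simp)
qed (subst bit_merge.simps, simp)

text \<open>In the induction step, \<open>half_split\<close> contributes \<open>2 ^ p\<close>, the
  recursive call \<open>p * 2 ^ p\<close> and the full merger \<open>Suc p * 2 ^ p\<close>, in total
  \<open>Suc p * 2 ^ Suc p\<close>.\<close>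

lemma length_half_bit_merge: "length (half_bit_merge (2 ^ Suc p)) = p * 2 ^ p"
proof (induction p)
  case (Suc p)
  have "(2::nat) ^ Suc (Suc p) > 2" using one_less_power[of "2::nat" "Suc p"] by simp
  then show ?case using Suc length_bit_merge[of "Suc p"]
    by (subst half_bit_merge.simps) (simp add: half_split_def par_def relabel_def algebra_simps)
qed (subst half_bit_merge.simps, simp)

lemma length_pw_hbit_merge: "length (pw_hbit_merge n (2 ^ Suc p)) = Suc p * 2 ^ p"
  using length_half_bit_merge[of p] by (simp add: pw_hbit_merge_def relabel_def bit_split_def)

section \<open>The first step and selection of the \<open>k\<close> largest entries\<close>

lemma run_bit_split:
  assumes "length xs = 2 * h" "i < h"
  shows "run (bit_split (2 * h)) xs ! i = max (xs ! i) (xs ! (2 * h - 1 - i))"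
    and "run (bit_split (2 * h)) xs ! (2 * h - 1 - i) = min (xs ! i) (xs ! (2 * h - 1 - i))"
proof -
  have "inj_on (\<lambda>i. 2 * h - 1 - i) (set [0..<h])" by (auto simp: inj_on_def)
  moreover have "(\<lambda>i. 2 * h - 1 - i) ` set [0..<h] \<inter> set [0..<h] = {}" by auto
  ultimately show "run (bit_split (2 * h)) xs ! i = max (xs ! i) (xs ! (2 * h - 1 - i))"
    and "run (bit_split (2 * h)) xs ! (2 * h - 1 - i) = min (xs ! i) (xs ! (2 * h - 1 - i))"
    using run_disjoint[of "[0..<h]" "\<lambda>i. 2 * h - 1 - i" xs] assms
    by (auto simp: bit_split_def)
qed

text \<open>Joins both clauses of \<open>top_sorted\<close>: sortedness of the prefix covers
  \<open>j < k\<close>, domination covers the rest.\<close>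

lemma top_sorted_nth:
  assumes "top_sorted k xs" "i \<le> j" "i < k" "j < length xs"
  shows "xs ! j \<le> xs ! i"
proof (cases "j < k")
  case True
  then show ?thesis
    using assms sorted_wrt_nth_less[of "(\<ge>)" "take k xs" i j]
    by (cases "i = j") (auto simp: top_sorted_def sorted_seq_def)
next
  case False
  then have "xs ! i \<in> set (take k xs)" "xs ! j \<in> set (drop k xs)"
    using assms by (force simp: in_set_conv_nth intro: exI[of _ i] exI[of _ "j - k"])+
  then show ?thesis using assms by (auto simp: top_sorted_def dominates_def)
qed

text \<open>Appending \<open>ys\<close> in descending order to \<open>xs\<close> gives a descending
  list with the entries of \<open>zs\<close>, and there is only one such list.\<close>

lemma take_rev_sort_eqI:
  assumes "sorted_seq xs" "mset zs = mset xs + mset ys" "dominates xs ys"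
  shows "take (length xs) (rev (sort zs)) = xs"
proof -
  have "sorted_seq (xs @ rev (sort ys))"
    using assms(1,3) by (auto simp: sorted_seq_def dominates_def sorted_wrt_append sorted_wrt_rev)
  then have "sorted (rev (xs @ rev (sort ys)))"
    by (simp only: sorted_seq_def sorted_wrt_rev)
  then have "sort zs = rev (xs @ rev (sort ys))"
    using assms(2) by (intro properties_for_sort) (simp_all add: add.commute)
  then show ?thesis by simp
qed

theorem theorem3:
  fixes n k :: nat and l r y b :: "nat list"
  assumes "power_of_2 n" and "power_of_2 k" and "2 \<le> k" and "k \<le> n div 2"
    and "length l = n div 2" and "length r = n div 2"
    and "top_sorted k l" and "top_sorted (k div 2) r"
    and "\<forall>i < k div 2. l ! i \<ge> r ! i"
    and "y = run (bit_split k) (drop (k div 2) (take k l) @ take (k div 2) r)"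
    and "b = take (k div 2) l @ take (k div 2) y"
  shows "take k (run (pw_hbit_merge n k) (l @ r)) = run (half_bit_merge k) b \<and>
    sorted_seq (run (half_bit_merge k) b) \<and>
    run (half_bit_merge k) b = take k (rev (sort (l @ r))) \<and>
    real (length (pw_hbit_merge n k)) = real k * log 2 (real k) / 2"
proof -
  obtain p0 where p0: "k = 2 ^ p0" using assms(2) by (auto simp: power_of_2_def)
  then obtain p where p: "k = 2 ^ Suc p" using \<open>2 \<le> k\<close> by (cases p0) auto
  define h where "h = k div 2"
  have k: "k = 2 * h" "h > 0" using p by (simp_all add: h_def)
  define w where "w = drop h (take k l) @ take h r"
  have len: "k \<le> length l" "h \<le> length r" "length l = length r" "length w = 2 * h"
    using assms(4-6) k by (auto simp: w_def)
  have y: "y = run (bit_split (2 * h)) w" using assms(10) by (simp add: w_def k)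
  have w1: "w ! i = l ! (h + i)" if "i < h" for i
    using that len k by (simp add: w_def nth_append)
  \<comment> \<open>The mirror position falls into the \<open>r\<close> part of \<open>w\<close>, so
    the first step pairs the second half of the prefix of \<open>l\<close> with the prefix of
    \<open>r\<close> read backwards.\<close>
  have w2: "w ! (2 * h - 1 - i) = r ! (h - 1 - i)" if "i < h" for i
  proof -
    have "w ! (h + (h - 1 - i)) = r ! (h - 1 - i)" using that len k by (auto simp: w_def nth_append)
    moreover have "h + (h - 1 - i) = 2 * h - 1 - i" using that by simp
    ultimately show ?thesis by simp
  qed
  have ly: "length y = 2 * h" by (simp add: y len)
  have y1: "y ! i = max (l ! (h + i)) (r ! (h - 1 - i))" if "i < h" for i
    using run_bit_split(1)[OF len(4) that] w1 w2 that by (simp add: y)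
  have y2: "y ! (2 * h - 1 - i) = min (l ! (h + i)) (r ! (h - 1 - i))" if "i < h" for i
    using run_bit_split(2)[OF len(4) that] w1 w2 that by (simp add: y)
  have b: "b = take h l @ take h y" using assms(11) by (simp add: h_def)
  have lb: "length b = k" using len ly k by (simp add: b)
  have b1: "b ! i = l ! i" if "i < h" for i using that len k by (simp add: b nth_append)
  have b2: "b ! (h + i) = y ! i" if "i < h" for i using that len k ly by (simp add: b nth_append)
  have L: "l ! j \<le> l ! i" if "i \<le> j" "i < k" "j < length l" for i j
    using top_sorted_nth[OF assms(7)] that by blast
  have R: "r ! j \<le> r ! i" if "i \<le> j" "i < h" "j < length r" for i j
    using top_sorted_nth[OF assms(8)] that by (simp add: h_def)
  have LR: "r ! i \<le> l ! i" if "i < h" for i using assms(9) that by (simp add: h_def)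
  have "v_shaped b"
    unfolding v_shaped_def
  proof (intro allI impI)
    fix i j q assume o: "i \<le> j" "j \<le> q" "q < length b"
    show "b ! j \<le> max (b ! i) (b ! q)"
    proof (cases "j < h")
      case True
      then show ?thesis using o L[of i j] k len by (simp add: b1 le_max_iff_disj)
    next
      case False
      define j' q' where "j' = j - h" and "q' = q - h"
      have jq: "j = h + j'" "q = h + q'" "j' \<le> q'" "q' < h"
        using False o lb k by (auto simp: j'_def q'_def)
      \<comment> \<open>The second half of \<open>b\<close> is the pointwise maximum of a falling
        part of \<open>l\<close> and a rising part, \<open>r\<close> read backwards. The
        \<open>r\<close> term is bounded at the right end \<open>q\<close>, the \<open>l\<close>
        term at the left end \<open>i\<close>.\<close>
      have "r ! (h - 1 - j') \<le> b ! q"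
        using R[of "h - 1 - q'" "h - 1 - j'"] jq k len by (simp add: b2 y1 le_max_iff_disj)
      moreover have "l ! j \<le> b ! i"
      proof (cases "i < h")
        case True
        then show ?thesis using L[of i j] o k len jq by (simp add: b1)
      next
        case False
        then obtain i' where "i = h + i'" using le_Suc_ex by (metis not_less)
        then show ?thesis using L[of i j] o k len jq by (simp add: b2 y1 le_max_iff_disj)
      qed
      ultimately show ?thesis using jq by (auto simp: b2 y1)
    qed
  qed
  moreover have "mirror_dominating b"
    unfolding mirror_dominating_def lb
  proof (intro allI impI)
    fix i assume "i < k div 2"
    then have i: "i < h" by (simp add: h_def)
    define i' where "i' = h - 1 - i"
    have i': "i' < h" "k - 1 - i = h + i'" "h - 1 - i' = i" using i k by (auto simp: i'_def)
    \<comment> \<open>The entry mirrored to \<open>i\<close> is the maximum of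
      \<open>l ! (h + i')\<close> and \<open>r ! i\<close>; the order of \<open>l\<close> bounds the
      first, \<open>LR\<close> the second.\<close>
    have "l ! (h + i') \<le> l ! i" using L[of i "h + i'"] i i' k len by simp
    then show "b ! (k - 1 - i) \<le> b ! i"
      using i LR[OF i] unfolding i'(2) b2[OF i'(1)] y1[OF i'(1)] i'(3) b1[OF i] by simp
  qed
  ultimately have S: "sorted_seq (run (half_bit_merge k) b)"
    using sorted_half_bit_merge[of b p] lb p by simp
  have M: "mset (run (half_bit_merge k) b) = mset b"
    by (intro mset_run) (simp add: lb network_on_half_bit_merge)
  \<comment> \<open>All entries outside \<open>b\<close>: the minima of the first step and the tails
    of \<open>l\<close> and \<open>r\<close>.\<close>
  define rest where "rest = drop h y @ drop k l @ drop h r"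
  have "mset y = mset w" unfolding y by (intro mset_run) (simp add: len network_on_bit_split)
  moreover have "mset y = mset (take h y) + mset (drop h y)"
    by (metis append_take_drop_id mset_append)
  moreover have "mset l = mset (take h l) + mset (drop h (take k l)) + mset (drop k l)"
  proof -
    have "l = take h (take k l) @ drop h (take k l) @ drop k l"
      by (metis append.assoc append_take_drop_id)
    moreover have "take h (take k l) = take h l" by (simp add: k)
    ultimately show ?thesis by (metis add.assoc mset_append)
  qed
  moreover have "mset r = mset (take h r) + mset (drop h r)"
    by (metis append_take_drop_id mset_append)
  ultimately have split: "mset (l @ r) = mset b + mset rest"
    by (simp add: b rest_def w_def)
  have dom: "dominates b rest"
    unfolding dominates_def
  proof (intro ballI)
    fix x z assume x: "x \<in> set b" and z: "z \<in> set rest"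
    from x obtain i where i: "i < h" "x = l ! i \<or> x = max (l ! (h + i)) (r ! (h - 1 - i))"
      using len ly k by (auto simp: b in_set_conv_nth y1)
    consider j where "j < h" "z = y ! (h + j)" | j where "k \<le> j" "j < length l" "z = l ! j"
      | j where "h \<le> j" "j < length r" "z = r ! j"
    proof -
      from z consider "z \<in> set (drop h y)" | "z \<in> set (drop k l)" | "z \<in> set (drop h r)"
        by (auto simp: rest_def)
      then show ?thesis
      proof cases
        case 1
        then obtain j where "j < length (drop h y)" "z = drop h y ! j" by (metis in_set_conv_nth)
        then show ?thesis using that(1)[of j] ly by simp
      next
        case 2
        then obtain j where "j < length (drop k l)" "z = drop k l ! j" by (metis in_set_conv_nth)
        then show ?thesis using that(2)[of "k + j"] by simp
      next
        case 3
        then obtain j where "j < length (drop h r)" "z = drop h r ! j" by (metis in_set_conv_nth)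
        then show ?thesis using that(3)[of "h + j"] by simp
      qed
    qed
    then show "z \<le> x"
    proof cases
      case 1
      \<comment> \<open>\<open>z\<close> is the minimum of the pair with index \<open>j'\<close>. As
        the index grows, the \<open>l\<close> member falls and the \<open>r\<close> member rises, so
        however \<open>i\<close> and \<open>j'\<close> compare, one member at \<open>j'\<close> is
        at most its counterpart at \<open>i\<close>.\<close>
      define j' where "j' = h - 1 - j"
      have j': "j' < h" "h + j = 2 * h - 1 - j'" using 1 by (auto simp: j'_def)
      have z: "z = min (l ! (h + j')) (r ! (h - 1 - j'))" using y2 j' 1 by simp
      have "l ! (h + j') \<le> l ! i" using L[of i "h + j'"] i j' k len by simp
      moreover have "l ! (h + j') \<le> l ! (h + i)" if "i \<le> j'"
        using L[of "h + i" "h + j'"] that i j' k len by simp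
      moreover have "r ! (h - 1 - j') \<le> r ! (h - 1 - i)" if "j' \<le> i"
        using R[of "h - 1 - i" "h - 1 - j'"] that i j' k len by simp
      ultimately show ?thesis using i z by (cases "i \<le> j'") (auto simp: min_le_iff_disj le_max_iff_disj)
    next
      case 2
      then show ?thesis using i L[of i j] L[of "h + i" j] k len by (auto simp: le_max_iff_disj)
    next
      case 3
      \<comment> \<open>\<open>r ! j\<close> is at most \<open>r ! (h - 1 - i)\<close>, and at most
        \<open>r ! i\<close>, hence at most \<open>l ! i\<close>.\<close>
      then show ?thesis using i R[of i j] R[of "h - 1 - i" j] LR[of i] k len
        by (auto simp: le_max_iff_disj)
    qed
  qed
  \<comment> \<open>\<open>M\<close> carries \<open>split\<close> and \<open>dom\<close> over from
    \<open>b\<close> to the merged list.\<close>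
  have "take k (rev (sort (l @ r))) = run (half_bit_merge k) b"
    using take_rev_sort_eqI[OF S, of "l @ r" rest] M split dom lb dominates_mset[OF M refl]
    by simp
  moreover have "take k (run (pw_hbit_merge n k) (l @ r)) = run (half_bit_merge k) b"
    using run_pw_hbit_merge[of k n l r] assms k by simp
  moreover have "real (length (pw_hbit_merge n k)) = real k * log 2 (real k) / 2"
  proof -
    have "log 2 (real k) = real (Suc p)" unfolding p of_nat_power by (subst log_nat_power) simp_all
    moreover have "real (length (pw_hbit_merge n k)) = real (Suc p) * 2 ^ p"
      unfolding p length_pw_hbit_merge by (simp add: algebra_simps)
    moreover have "real k = 2 * 2 ^ p" by (simp add: p)
    ultimately show ?thesis by (simp del: of_nat_Suc)
  qed
  ultimately show ?thesis using S by simp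
qed

end
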